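(* For all $n \geq 4$, \[\text{ex}(n,I_1)=\text{ex}_o(n,I_1) = n \left\lfloor \frac{n-1}{2} \right\rfloor,\] and there are \[\left(\frac{(n-1)!}{2^{\left\lfloor \frac{n-1}{2} \right\rfloor} \left \lfloor \frac{n-1}{2} \right\rfloor !}\right)^n\] labeled $I_1$-free $(2\to1)$-graphs (on the fixed vertex set $\{1,\dots,n\}$, not required to be oriented) that attain this maximum number of edges.
   Context: A $(2\to 1)$-graph (directed hypergraph) is a pair $H=(V,E)$ with $V$ a finite set and $E$ a set of pointed $3$-subsets of $V$: an edge, written $ab\to c$ (same as $ba\to c$), consists of three distinct vertices with head $c$ and tail set $\{a,b\}$. $H$ is oriented if every $3$-subset of $V$ carries at most one edge (in general it may carry up to three). $H$ is $F$-free if there is no injective map $\phi:V(F)\to V(H)$ such that $ab\to c\in E(F)$ implies $\phi(a)\phi(b)\to\phi(c)\in E(H)$. $\text{ex}(n,F)$ (resp. $\text{ex}_o(n,F)$) is the maximum number of edges of an $F$-free $(2\to1)$-graph (resp. $F$-free oriented $(2\to1)$-graph) on $n$ vertices. $I_1$ is the $(2\to1)$-graph with vertex set $\{a,b,c,d\}$ (four distinct vertices) and edges $ab\to c$, $ad\to c$. *)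

theory Defs
  imports Complex_Main
begin

text \<open>
  The edge \<open>ab \<rightarrow> c\<close> is the pair \<open>({a, b}, c)\<close> of its tail set and its head.
\<close>

record 'a two_one_graph =
  verts :: "'a set"
  edges :: "('a set \<times> 'a) set"

definition is_two_one_graph :: "'a two_one_graph \<Rightarrow> bool" where
  "is_two_one_graph H \<longleftrightarrow> finite (verts H) \<and>
     (\<forall>(T, c) \<in> edges H. T \<subseteq> verts H \<and> c \<in> verts H \<and> card T = 2 \<and> c \<notin> T)"

definition oriented :: "'a two_one_graph \<Rightarrow> bool" where
  "oriented H \<longleftrightarrow>
     (\<forall>S. S \<subseteq> verts H \<and> card S = 3 \<longrightarrow> card {(T, c) \<in> edges H. insert c T = S} \<le> 1)"

definition is_free :: "'b two_one_graph \<Rightarrow> 'a two_one_graph \<Rightarrow> bool" where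
  "is_free F H \<longleftrightarrow>
     \<not> (\<exists>\<phi>. inj_on \<phi> (verts F) \<and> \<phi> ` verts F \<subseteq> verts H \<and>
           (\<forall>a b c. ({a, b}, c) \<in> edges F \<longrightarrow> ({\<phi> a, \<phi> b}, \<phi> c) \<in> edges H))"

text \<open>
  Every finite vertex set has a copy in the natural numbers, so it suffices to let the host
  graphs range over graphs with vertices in \<open>nat\<close>. The sets under \<open>Max\<close> are finite (see
  \<open>finite_free_edge_counts\<close> below); they are nonempty as soon as \<open>F\<close> has an edge.
\<close>

definition ex_number :: "nat \<Rightarrow> 'b two_one_graph \<Rightarrow> nat" where
  "ex_number n F = Max {card (edges H) | H :: nat two_one_graph.
     is_two_one_graph H \<and> card (verts H) = n \<and> is_free F H}"

definition ex_oriented_number :: "nat \<Rightarrow> 'b two_one_graph \<Rightarrow> nat" where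
  "ex_oriented_number n F = Max {card (edges H) | H :: nat two_one_graph.
     is_two_one_graph H \<and> card (verts H) = n \<and> oriented H \<and> is_free F H}"

text \<open>The vertices \<open>a, b, c, d\<close> of \<open>I\<^sub>1\<close> are \<open>0, 1, 2, 3\<close>.\<close>

definition I1 :: "nat two_one_graph" where
  "I1 = \<lparr>verts = {0, 1, 2, 3}, edges = {({0, 1}, 2), ({0, 3}, 2)}\<rparr>"

lemma is_two_one_graph_I1: "is_two_one_graph I1"
  by (simp add: is_two_one_graph_def I1_def)

lemma card_edges_le:
  assumes "is_two_one_graph H"
  shows "card (edges H) \<le> 2 ^ card (verts H) * card (verts H)"
proof -
  have fin: "finite (verts H)" and sub: "edges H \<subseteq> Pow (verts H) \<times> verts H"
    using assms by (auto simp: is_two_one_graph_def)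
  have "card (edges H) \<le> card (Pow (verts H) \<times> verts H)"
    using fin sub by (intro card_mono) auto
  then show ?thesis
    using fin by (simp add: card_cartesian_product card_Pow)
qed

lemma finite_free_edge_counts:
  "finite {card (edges H) | H :: nat two_one_graph.
     is_two_one_graph H \<and> card (verts H) = n \<and> is_free F H}"
  "finite {card (edges H) | H :: nat two_one_graph.
     is_two_one_graph H \<and> card (verts H) = n \<and> oriented H \<and> is_free F H}"
  by (rule finite_subset[of _ "{.. 2 ^ n * n}"]; use card_edges_le in fastforce)+

end

theory Submission
  imports Defs "HOL-Library.FuncSet"
begin

text \<open>
  In an \<open>I\<^sub>1\<close>-free graph the tails of the edges with a given head \<open>c\<close> form a matching of the
  other \<open>n - 1\<close> vertices, and conversely such matchings can be chosen independently for all heads.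
  This gives the upper bound and the number of extremal graphs.

  An oriented extremal graph comes from an operation \<open>p\<close> for which every \<open>p c\<close> is an involution
  fixing \<open>c\<close>, the tails with head \<open>c\<close> being the two-element orbits of \<open>p c\<close>; two edges on the same
  triple amount to a coincidence \<open>p c a = p a c\<close>. For even \<open>n\<close> all \<open>p c\<close> come from one perfect
  matching. For odd \<open>n\<close> take the reflections \<open>2c - a\<close> in the integers modulo \<open>n\<close>. If \<open>n = 3k\<close>
  these produce the bad triples \<open>c, c + k, c - k\<close>, which disappear once the pairs
  \<open>c \<plusminus> 1\<close> and \<open>c \<plusminus> k\<close> are replaced by \<open>{c + 1, c + k}\<close> and \<open>{c - 1, c - k}\<close>.
\<close>

section \<open>Matchings\<close>

definition matchings :: "'a set \<Rightarrow> nat \<Rightarrow> 'a set set set" where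
  "matchings A m = {M. (\<forall>T\<in>M. T \<subseteq> A \<and> card T = 2) \<and> pairwise disjnt M \<and> card M = m}"

lemma matchingsD:
  assumes "M \<in> matchings A m"
  shows "\<And>T. T \<in> M \<Longrightarrow> T \<subseteq> A" "\<And>T. T \<in> M \<Longrightarrow> card T = 2" "pairwise disjnt M" "card M = m"
  using assms by (auto simp: matchings_def)

lemma card_Union_pairs:
  assumes "pairwise disjnt M" "\<And>T. T \<in> M \<Longrightarrow> card T = 2"
  shows "card (\<Union>M) = 2 * card M"
proof -
  have "card (\<Union>M) = sum card M"
    using assms(1) by (rule card_Union_disjoint) (metis assms(2) card.infinite zero_neq_numeral)
  then show ?thesis using assms(2) by simp
qed

lemma card_matching_le:
  assumes "finite A" "M \<in> matchings A m"
  shows "m \<le> card A div 2"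
proof -
  note M = matchingsD[OF assms(2)]
  have "2 * m = card (\<Union>M)" using card_Union_pairs[of M] M by metis
  also have "\<dots> \<le> card A" using M(1) assms(1) by (intro card_mono) auto
  finally show ?thesis by simp
qed

section \<open>Counting the matchings of a given size\<close>

lemma finite_matchings: "finite A \<Longrightarrow> finite (matchings A m)"
  by (rule finite_subset[of _ "Pow (Pow A)"]) (auto simp: matchings_def)

lemma finite_matching: "finite A \<Longrightarrow> M \<in> matchings A m \<Longrightarrow> finite M"
  by (rule finite_subset[of _ "Pow A"]) (auto simp: matchings_def)

text \<open>Deleting \<open>T\<close> is a bijection: disjointness puts the remaining pairs inside
  \<open>A - T\<close>, and \<open>T\<close> can be added back to any matching there.\<close>

lemma card_matchings_containing:
  assumes "finite A" "T \<subseteq> A" "card T = 2"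
  shows "card {M \<in> matchings A (Suc m). T \<in> M} = card (matchings (A - T) m)"
proof (rule bij_betw_same_card[of "\<lambda>M. M - {T}"], rule bij_betw_byWitness[where f' = "insert T"])
  \<comment> \<open>Members of a matching of \<open>A - T\<close> are subsets of
    \<open>A - T\<close>, so nonemptiness keeps \<open>T\<close> from being one of them.\<close>
  have ne: "T \<noteq> {}" using assms(3) by auto
  show "\<forall>M \<in> {M \<in> matchings A (Suc m). T \<in> M}. insert T (M - {T}) = M" by auto
  show "\<forall>M \<in> matchings (A - T) m. insert T M - {T} = M"
    using ne by (auto simp: matchings_def)
  show "(\<lambda>M. M - {T}) ` {M \<in> matchings A (Suc m). T \<in> M} \<subseteq> matchings (A - T) m"
  proof clarify
    fix M assume M: "M \<in> matchings A (Suc m)" "T \<in> M"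
    note D = matchingsD[OF M(1)]
    have "S \<subseteq> A - T" if "S \<in> M - {T}" for S
      using D(1)[of S] D(3) that M(2) unfolding pairwise_def disjnt_def by blast
    moreover have "card (M - {T}) = m" using M(2) D(4) by simp
    ultimately show "M - {T} \<in> matchings (A - T) m"
      using D(2,3) by (auto simp: matchings_def intro: pairwise_subset)
  qed
  show "insert T ` matchings (A - T) m \<subseteq> {M \<in> matchings A (Suc m). T \<in> M}"
  proof clarify
    fix M assume M: "M \<in> matchings (A - T) m"
    note D = matchingsD[OF M]
    have "finite M" using finite_matching M assms(1) by blast
    moreover have "T \<notin> M" using D(1) ne by blast
    ultimately have "card (insert T M) = Suc m" using D(4) by simp
    moreover have "pairwise disjnt (insert T M)"
      using D(1,3) by (fastforce simp: pairwise_insert disjnt_def)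
    ultimately show "insert T M \<in> matchings A (Suc m) \<and> T \<in> insert T M"
      using D(1,2) assms by (auto simp: matchings_def)
  qed
qed

text \<open>Double counting of the incidences \<open>T \<in> M\<close>: every matching contains
  \<open>Suc m\<close> pairs, and every pair lies in \<open>k\<close> matchings.\<close>

lemma card_matchings_Suc:
  assumes "finite A"
    and "\<And>T. T \<subseteq> A \<Longrightarrow> card T = 2 \<Longrightarrow> card (matchings (A - T) m) = k"
  shows "Suc m * card (matchings A (Suc m)) = (card A choose 2) * k"
proof -
  let ?P = "{T. T \<subseteq> A \<and> card T = 2}"
  have finP: "finite ?P" using assms(1) by simp
  have "Suc m * card (matchings A (Suc m)) = (\<Sum>M\<in>matchings A (Suc m). card {T \<in> ?P. T \<in> M})"
  proof -
    have "card {T \<in> ?P. T \<in> M} = Suc m" if "M \<in> matchings A (Suc m)" for M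
    proof -
      have "{T \<in> ?P. T \<in> M} = M" using matchingsD(1,2)[OF that] by auto
      then show ?thesis using matchingsD(4)[OF that] by simp
    qed
    then show ?thesis by simp
  qed
  also have "\<dots> = (\<Sum>T\<in>?P. card {M \<in> matchings A (Suc m). T \<in> M})"
    using sum.swap_restrict[OF finite_matchings[OF assms(1)] finP,
        of "\<lambda>_ _. 1::nat" "\<lambda>M T. T \<in> M" "Suc m"]
    by simp
  also have "\<dots> = (\<Sum>T\<in>?P. k)"
    using card_matchings_containing[OF assms(1)] assms(2) by (intro sum.cong) auto
  also have "\<dots> = (card A choose 2) * k" using n_subsets[OF assms(1), of 2] by simp
  finally show ?thesis .
qed

text \<open>The multiplicative form keeps the induction in the naturals. Removing one pair lowers
  \<open>card A\<close> by two and \<open>m\<close> by one, so the number of uncovered points stays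
  the same.\<close>

lemma card_matchings:
  assumes "finite A" "2 * m \<le> card A"
  shows "card (matchings A m) * (2 ^ m * fact m * fact (card A - 2 * m)) = fact (card A)"
  using assms
proof (induction m arbitrary: A)
  case 0
  have "matchings A 0 = {{}}"
    using finite_matching[OF 0(1)] by (auto simp: matchings_def card_eq_0_iff)
  then show ?case by simp
next
  case (Suc m)
  obtain N where N: "card A = Suc (Suc N)"
    using Suc.prems(2) by (metis add_2_eq_Suc le_Suc_ex mult_Suc_right add.assoc)
  let ?d = "2 ^ m * fact m * fact (N - 2 * m) :: nat"
  have IH: "card (matchings (A - T) m) * ?d = fact N" if "T \<subseteq> A" "card T = 2" for T
  proof -
    have "card (A - T) = N"
      using that N Suc.prems(1) by (simp add: card_Diff_subset finite_subset)
    then show ?thesis using Suc.IH[of "A - T"] Suc.prems N by simp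
  qed
  \<comment> \<open>The double count needs one constant valid for all pairs \<open>T\<close>, so the
    induction hypothesis is solved for the cardinality.\<close>
  have "card (matchings (A - T) m) = fact N div ?d" if "T \<subseteq> A" "card T = 2" for T
    by (metis IH[OF that] nonzero_mult_div_cancel_right fact_nonzero mult_eq_0_iff)
  then have rec: "Suc m * card (matchings A (Suc m)) = (card A choose 2) * (fact N div ?d)"
    by (rule card_matchings_Suc[OF Suc.prems(1)])
  \<comment> \<open>The induction hypothesis for a single pair already shows that this division is
    exact.\<close>
  obtain T where "T \<subseteq> A" "card T = 2"
    using N obtain_subset_with_card_n[of 2 A] by auto
  then have div: "fact N div ?d * ?d = fact N"
    using IH by (metis dvd_triv_right dvd_div_mult_self)
  have choose: "2 * (Suc (Suc N) choose 2) = Suc (Suc N) * Suc N"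
    unfolding choose_two by simp
  have "card (matchings A (Suc m)) * (2 ^ Suc m * fact (Suc m) * fact (card A - 2 * Suc m))
      = 2 * (Suc m * card (matchings A (Suc m))) * ?d"
    using N by (simp add: algebra_simps)
  also have "\<dots> = 2 * (card A choose 2) * (fact N div ?d * ?d)"
    unfolding rec by (simp only: mult.assoc)
  also have "\<dots> = fact (card A)"
    unfolding div N choose by (simp add: algebra_simps)
  finally show ?case .
qed

lemma card_maximum_matchings:
  assumes "finite A"
  shows "real (card (matchings A (card A div 2)))
    = fact (card A) / (2 ^ (card A div 2) * fact (card A div 2))"
proof -
  \<comment> \<open>A maximum matching leaves at most one point uncovered, so the last factor is 0!
    or 1!.\<close>
  have "fact (card A - 2 * (card A div 2)) = (1::nat)"
    by (cases "even (card A)") (auto elim!: oddE)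
  then have "card (matchings A (card A div 2)) * (2 ^ (card A div 2) * fact (card A div 2))
      = fact (card A)"
    using card_matchings[OF assms, of "card A div 2"] by simp
  then have "real (card (matchings A (card A div 2))) * (2 ^ (card A div 2) * fact (card A div 2))
      = fact (card A)"
    using arg_cong[of _ _ real] by fastforce
  then show ?thesis by (simp add: field_simps)
qed

section \<open>Links\<close>

definition link :: "'a two_one_graph \<Rightarrow> 'a \<Rightarrow> 'a set set" where
  "link H c = {T. (T, c) \<in> edges H}"

text \<open>A copy of \<open>I1\<close> is a pair of edges with a common head whose tails share
  exactly one vertex, and distinct two-element tails that meet share exactly one.\<close>

lemma free_I1_iff:
  assumes "is_two_one_graph H"
  shows "is_free I1 H \<longleftrightarrow> (\<forall>c. pairwise disjnt (link H c))"
proof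
  assume free: "is_free I1 H"
  show "\<forall>c. pairwise disjnt (link H c)"
  proof (intro allI pairwiseI, rule ccontr)
    fix c S T
    assume ST: "S \<in> link H c" "T \<in> link H c" "S \<noteq> T" "\<not> disjnt S T"
    then obtain x where x: "x \<in> S" "x \<in> T" by (auto simp: disjnt_def)
    have E: "(S, c) \<in> edges H" "(T, c) \<in> edges H" using ST by (auto simp: link_def)
    then have VS: "S \<subseteq> verts H" "T \<subseteq> verts H" "c \<in> verts H" "c \<notin> S" "c \<notin> T"
      and card2: "card S = 2" "card T = 2"
      using assms by (auto simp: is_two_one_graph_def)
    obtain b where b: "S = {x, b}" "b \<noteq> x" using card2(1) x(1) by (auto simp: card_2_iff)
    obtain d where d: "T = {x, d}" "d \<noteq> x" using card2(2) x(2) by (auto simp: card_2_iff)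
    \<comment> \<open>In \<open>I1\<close> the vertex \<open>0\<close> is common to both tails and
      \<open>2\<close> is the head.\<close>
    define \<phi> where "\<phi> = (\<lambda>i::nat. if i = 0 then x else if i = 1 then b else if i = 2 then c else d)"
    have "inj_on \<phi> (verts I1)" "\<phi> ` verts I1 \<subseteq> verts H"
      using VS b d ST(3) by (auto simp: I1_def \<phi>_def inj_on_def)
    moreover have "({\<phi> i, \<phi> j}, \<phi> k) \<in> edges H" if "({i, j}, k) \<in> edges I1" for i j k
      using that E b d by (auto simp: I1_def \<phi>_def doubleton_eq_iff insert_commute)
    ultimately show False using free unfolding is_free_def by blast
  qed
next
  assume disj: "\<forall>c. pairwise disjnt (link H c)"
  show "is_free I1 H"
    unfolding is_free_def
  proof clarify
    fix \<phi> :: "nat \<Rightarrow> 'a"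
    assume inj: "inj_on \<phi> (verts I1)"
      and hom: "\<forall>a b c. ({a, b}, c) \<in> edges I1 \<longrightarrow> ({\<phi> a, \<phi> b}, \<phi> c) \<in> edges H"
    have "({0, 1}, 2) \<in> edges I1" "({0, 3}, 2) \<in> edges I1" by (auto simp: I1_def)
    then have "{\<phi> 0, \<phi> 1} \<in> link H (\<phi> 2)" "{\<phi> 0, \<phi> 3} \<in> link H (\<phi> 2)"
      using hom unfolding link_def by blast+
    \<comment> \<open>Both tails contain the image of \<open>0\<close>, so they are not disjoint and
      must coincide.\<close>
    then have "{\<phi> 0, \<phi> 1} = {\<phi> 0, \<phi> 3}"
      using disj by (metis pairwiseD disjnt_iff insertI1)
    then have "\<phi> 1 = \<phi> 3" by (auto simp: doubleton_eq_iff)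
    then show False using inj by (auto simp: I1_def inj_on_def)
  qed
qed

section \<open>Upper bound for the number of edges and its equality case\<close>

lemma link_matching:
  assumes "is_two_one_graph H" "is_free I1 H"
  shows "link H c \<in> matchings (verts H - {c}) (card (link H c))"
  using assms free_I1_iff[OF assms(1)] by (auto simp: matchings_def link_def is_two_one_graph_def)

lemma card_edges_eq_sum_link:
  assumes "is_two_one_graph H"
  shows "card (edges H) = (\<Sum>c\<in>verts H. card (link H c))"
proof -
  have fin: "finite (verts H)" using assms by (simp add: is_two_one_graph_def)
  have finl: "finite (link H c)" for c
    by (rule finite_subset[of _ "Pow (verts H)"])
      (use assms in \<open>auto simp: link_def is_two_one_graph_def\<close>)
  have "edges H = prod.swap ` (SIGMA c:verts H. link H c)"
    using assms by (force simp: link_def is_two_one_graph_def image_iff)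
  then have "card (edges H) = card (SIGMA c:verts H. link H c)"
    by (simp add: card_image)
  then show ?thesis using fin finl by simp
qed

lemma card_link_le:
  assumes "is_two_one_graph H" "is_free I1 H" "c \<in> verts H"
  shows "card (link H c) \<le> (card (verts H) - 1) div 2"
proof -
  have "finite (verts H)" using assms(1) by (simp add: is_two_one_graph_def)
  then show ?thesis
    using card_matching_le[OF _ link_matching[OF assms(1,2)], of c] assms(3) by simp
qed

lemma card_edges_free_le:
  assumes "is_two_one_graph H" "is_free I1 H"
  shows "card (edges H) \<le> card (verts H) * ((card (verts H) - 1) div 2)"
  using sum_mono[OF card_link_le[OF assms]] card_edges_eq_sum_link[OF assms(1)] by simp

text \<open>The edge count is a sum of link sizes with a common upper bound, so it is maximal only
  if every term is.\<close>

lemma card_edges_free_eq_iff: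
  assumes "is_two_one_graph H" "is_free I1 H"
  shows "card (edges H) = card (verts H) * ((card (verts H) - 1) div 2)
    \<longleftrightarrow> (\<forall>c\<in>verts H. card (link H c) = (card (verts H) - 1) div 2)"
proof -
  have fin: "finite (verts H)" using assms(1) by (simp add: is_two_one_graph_def)
  show ?thesis
    using sum_mono_inv[OF _ card_link_le[OF assms] _ fin] card_edges_eq_sum_link[OF assms(1)]
    by auto
qed

section \<open>Extremal graphs as families of maximum matchings\<close>

text \<open>This inverts \<open>link\<close> on a fixed vertex set. As \<open>M\<close> is total,
  the condition \<open>c \<in> V\<close> discards its values elsewhere.\<close>

definition graph_of_links :: "'a set \<Rightarrow> ('a \<Rightarrow> 'a set set) \<Rightarrow> 'a two_one_graph" where
  "graph_of_links V M = \<lparr>verts = V, edges = {(T, c). c \<in> V \<and> T \<in> M c}\<rparr>"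

lemma link_graph_of_links: "link (graph_of_links V M) c = (if c \<in> V then M c else {})"
  by (auto simp: link_def graph_of_links_def)

lemma graph_of_links_link:
  assumes "is_two_one_graph H"
  shows "graph_of_links (verts H) (link H) = H"
  using assms
  by (intro two_one_graph.equality) (auto simp: graph_of_links_def link_def is_two_one_graph_def)

text \<open>Being \<open>I1\<close>-free constrains only edges with the same head, so matchings for
  different heads can be combined freely.\<close>

lemma graph_of_matchings:
  assumes "finite V" "\<And>c. c \<in> V \<Longrightarrow> M c \<in> matchings (V - {c}) m"
  shows "is_two_one_graph (graph_of_links V M)" "is_free I1 (graph_of_links V M)"
    "card (edges (graph_of_links V M)) = card V * m"
proof -
  show G: "is_two_one_graph (graph_of_links V M)"
    using assms matchingsD(1,2)[OF assms(2)] by (fastforce simp: is_two_one_graph_def graph_of_links_def)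
  show "is_free I1 (graph_of_links V M)"
    using matchingsD(3)[OF assms(2)] by (auto simp: free_I1_iff[OF G] link_graph_of_links)
  show "card (edges (graph_of_links V M)) = card V * m"
    using matchingsD(4)[OF assms(2)] card_edges_eq_sum_link[OF G]
    by (simp add: link_graph_of_links) (simp add: graph_of_links_def)
qed

lemma card_extremal_graphs:
  assumes "finite V"
  shows "real (card {H :: 'a two_one_graph. is_two_one_graph H \<and> verts H = V \<and> is_free I1 H \<and>
      card (edges H) = card V * ((card V - 1) div 2)})
    = (fact (card V - 1) / (2 ^ ((card V - 1) div 2) * fact ((card V - 1) div 2))) ^ card V"
proof -
  let ?m = "(card V - 1) div 2"
  \<comment> \<open>\<open>graph_of_links\<close> ignores values outside \<open>V\<close>;
    \<open>PiE\<close> fixes them, which makes the map injective.\<close>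
  let ?P = "PiE V (\<lambda>c. matchings (V - {c}) ?m)"
  have "{H. is_two_one_graph H \<and> verts H = V \<and> is_free I1 H \<and> card (edges H) = card V * ?m}
      = graph_of_links V ` ?P" (is "?X = _")
  proof (intro equalityI subsetI)
    fix H assume "H \<in> ?X"
    then have H: "is_two_one_graph H" "verts H = V" "is_free I1 H" "card (edges H) = card V * ?m"
      by auto
    have "card (link H c) = ?m" if "c \<in> V" for c
      using card_edges_free_eq_iff[OF H(1,3)] H(2,4) that by simp
    then have "link H c \<in> matchings (V - {c}) ?m" if "c \<in> V" for c
      using link_matching[OF H(1,3), of c] H(2) that by simp
    then have "restrict (link H) V \<in> ?P" by simp
    moreover have "graph_of_links V (restrict (link H) V) = H"
      using graph_of_links_link[OF H(1)] H(2) by (simp add: graph_of_links_def cong: conj_cong)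
    ultimately show "H \<in> graph_of_links V ` ?P" by (metis imageI)
  next
    fix H assume "H \<in> graph_of_links V ` ?P"
    then obtain M where M: "M \<in> ?P" "H = graph_of_links V M" by blast
    then show "H \<in> ?X"
      using graph_of_matchings[OF assms, of M ?m] by (auto simp: graph_of_links_def)
  qed
  moreover have "inj_on (graph_of_links V) ?P"
  proof (rule inj_onI)
    fix M N assume MN: "M \<in> ?P" "N \<in> ?P" "graph_of_links V M = graph_of_links V N"
    have "M c = N c" if "c \<in> V" for c
      using that MN(3) link_graph_of_links[of V M c] link_graph_of_links[of V N c] by simp
    then show "M = N" using MN(1,2) by (meson PiE_ext)
  qed
  ultimately have "card ?X = (\<Prod>c\<in>V. card (matchings (V - {c}) ?m))"
    using assms by (simp add: card_image card_PiE)
  moreover have "real (card (matchings (V - {c}) ?m)) = fact (card V - 1) / (2 ^ ?m * fact ?m)"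
    if "c \<in> V" for c
    using card_maximum_matchings[of "V - {c}"] assms that by simp
  ultimately show ?thesis by simp
qed

section \<open>Oriented extremal graphs\<close>

text \<open>An edge with head \<open>c\<close> and \<open>a\<close> in its tail has third vertex
  \<open>p c a\<close>. Two edges on one triple with different heads \<open>c\<close> and
  \<open>a\<close> would force \<open>p c a = p a c\<close>.\<close>

lemma oriented_graph_of_operation:
  assumes fin: "finite V"
    and closed: "\<And>c a. c \<in> V \<Longrightarrow> a \<in> V \<Longrightarrow> p c a \<in> V"
    and invol: "\<And>c a. c \<in> V \<Longrightarrow> a \<in> V \<Longrightarrow> p c (p c a) = a"
    and idem: "\<And>c. c \<in> V \<Longrightarrow> p c c = c"
    and anticomm: "\<And>c a. c \<in> V \<Longrightarrow> a \<in> V \<Longrightarrow> c \<noteq> a \<Longrightarrow> p c a \<noteq> a \<Longrightarrow> p c a \<noteq> p a c"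
    and moved: "\<And>c. c \<in> V \<Longrightarrow> card {a \<in> V. p c a \<noteq> a} = 2 * m"
  shows "\<exists>H. verts H = V \<and> is_two_one_graph H \<and> oriented H \<and> is_free I1 H \<and>
    card (edges H) = card V * m"
proof -
  define M where "M c = {{a, p c a} | a. a \<in> V \<and> p c a \<noteq> a}" for c
  have eqpair: "{a, p c a} = {b, p c b}" if "c \<in> V" "a \<in> V" "b \<in> {a, p c a}" for a b c
    using that invol by auto
  have M: "M c \<in> matchings (V - {c}) m" if c: "c \<in> V" for c
  proof -
    have sub: "T \<subseteq> V - {c}" "card T = 2" if T: "T \<in> M c" for T
    proof -
      obtain a where a: "a \<in> V" "p c a \<noteq> a" "T = {a, p c a}" using T by (auto simp: M_def)
      have "p c a \<noteq> c" using a invol idem c by metis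
      moreover have "a \<noteq> c" using a idem c by metis
      ultimately show "T \<subseteq> V - {c}" "card T = 2" using a closed c by auto
    qed
    have disj: "pairwise disjnt (M c)"
    proof (intro pairwiseI, rule ccontr)
      fix S T assume ST: "S \<in> M c" "T \<in> M c" "S \<noteq> T" "\<not> disjnt S T"
      then obtain a b where "a \<in> V" "b \<in> V" "S = {a, p c a}" "T = {b, p c b}"
        by (auto simp: M_def)
      moreover obtain x where "x \<in> S" "x \<in> T" using ST(4) by (auto simp: disjnt_def)
      ultimately show False using eqpair[OF c] ST(3) by metis
    qed
    have "\<Union>(M c) = {a \<in> V. p c a \<noteq> a}"
      using closed[OF c] invol[OF c] by (auto simp: M_def)
    then have "card (M c) = m"
      using card_Union_pairs[OF disj sub(2)] moved[OF c] by simp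
    then show ?thesis using sub disj by (auto simp: matchings_def)
  qed
  let ?H = "graph_of_links V M"
  \<comment> \<open>By the involution, any vertex \<open>d\<close> of a tail can serve as the
    representative from which the tail is generated.\<close>
  have head: "c \<in> V \<and> d \<in> V \<and> d \<noteq> c \<and> p c d \<noteq> d \<and> p c d \<noteq> c \<and> T = {d, p c d}"
    if "(T, c) \<in> edges ?H" "d \<in> T" for T c d
  proof -
    have c: "c \<in> V" and T: "T \<in> M c" using that(1) by (auto simp: graph_of_links_def)
    have sub: "T \<subseteq> V - {c}" "card T = 2" using matchingsD(1,2)[OF M[OF c] T] .
    obtain a where a: "a \<in> V" "T = {a, p c a}" using T by (auto simp: M_def)
    then have "T = {d, p c d}" using eqpair[OF c] that(2) by metis
    then show ?thesis using sub c by (auto simp: card_2_iff)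
  qed
  have unique: "(T, c) = (T', c')"
    if e: "(T, c) \<in> edges ?H" "(T', c') \<in> edges ?H" "insert c T = insert c' T'" for T c T' c'
  proof -
    have notin: "c \<notin> T" "c' \<notin> T'" using head e by blast+
    have "c = c'"
    proof (rule ccontr)
      assume "c \<noteq> c'"
      then have in': "c' \<in> T" "c \<in> T'" using e(3) by auto
      from head[OF e(1) in'(1)] head[OF e(2) in'(2)] have
        h: "c \<in> V" "c' \<in> V" "c' \<noteq> c" "p c c' \<noteq> c'" "p c c' \<noteq> c" "T = {c', p c c'}" "T' = {c, p c' c}"
        by auto
      \<comment> \<open>Each head lies in the tail of the other edge; cancelling both heads from the
        common triple leaves the third vertex.\<close>
      then have "p c c' = p c' c" using e(3) by auto
      then show False using anticomm h by metis
    qed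
    then show ?thesis using e(3) notin by auto
  qed
  have "oriented ?H"
    unfolding oriented_def
  proof (intro allI impI)
    fix S
    have "finite {(T, c) \<in> edges ?H. insert c T = S}"
      by (rule finite_subset[of _ "Pow V \<times> V"])
        (use fin graph_of_matchings(1)[OF fin M] in \<open>auto simp: is_two_one_graph_def graph_of_links_def\<close>)
    moreover have "e = e'"
      if "e \<in> {(T, c) \<in> edges ?H. insert c T = S}" "e' \<in> {(T, c) \<in> edges ?H. insert c T = S}" for e e'
      using that unique[of "fst e" "snd e" "fst e'" "snd e'"] by (simp add: case_prod_beta)
    ultimately show "card {(T, c) \<in> edges ?H. insert c T = S} \<le> 1"
      unfolding One_nat_def by (subst card_le_Suc0_iff_eq) blast+
  qed
  moreover have "verts ?H = V" by (simp add: graph_of_links_def)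
  ultimately show ?thesis using graph_of_matchings[OF fin M] by blast
qed

section \<open>Even order: one perfect matching for all heads\<close>

text \<open>The involution exchanging \<open>2 * i\<close> and \<open>2 * i + 1\<close>; it maps
  \<open>{..<n}\<close> into itself exactly when \<open>n\<close> is even.\<close>

definition partner :: "nat \<Rightarrow> nat" where
  "partner a = (if even a then a + 1 else a - 1)"

lemma partner: "partner (partner a) = a" "partner a \<noteq> a"
  by (cases a; simp add: partner_def)+

lemma partner_eq_iff: "partner a = partner b \<longleftrightarrow> a = b"
  by (metis partner(1))

lemma oriented_extremal_even:
  assumes "even n"
  shows "\<exists>H. verts H = {..<n} \<and> is_two_one_graph H \<and> oriented H \<and> is_free I1 H \<and>
    card (edges H) = n * ((n - 1) div 2)"
proof -
  \<comment> \<open>\<open>p c\<close> fixes the pair containing \<open>c\<close> and swaps all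
    others. If it moves \<open>a\<close>, then \<open>p c a = partner a\<close> and
    \<open>p a c = partner c\<close>, which differ for \<open>a \<noteq> c\<close>.\<close>
  define p where "p c a = (if a = c \<or> a = partner c then a else partner a)" for c a
  have lt: "partner a < n" if "a < n" for a
    using that assms by (cases "even a") (auto simp: partner_def elim!: evenE)
  have "\<exists>H. verts H = {..<n} \<and> is_two_one_graph H \<and> oriented H \<and> is_free I1 H \<and>
    card (edges H) = card {..<n} * ((n - 1) div 2)"
  proof (rule oriented_graph_of_operation[of _ p])
    fix c assume "c \<in> {..<n}"
    then have "card ({..<n} - {c, partner c}) = n - 2"
      using lt[of c] partner(2)[of c] by (subst card_Diff_subset) (auto simp: card_insert_if)
    moreover have "{a \<in> {..<n}. p c a \<noteq> a} = {..<n} - {c, partner c}"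
      using partner(2) by (auto simp: p_def)
    \<comment> \<open>The vertex \<open>partner c\<close> stays uncovered, matching the rounding
      down for even \<open>n\<close>.\<close>
    moreover have "n - 2 = 2 * ((n - 1) div 2)" using assms by presburger
    ultimately show "card {a \<in> {..<n}. p c a \<noteq> a} = 2 * ((n - 1) div 2)" by simp
  qed (use lt partner partner_eq_iff in \<open>auto simp: p_def split: if_splits\<close>)
  then show ?thesis by simp
qed

section \<open>Odd order: translation-invariant operations\<close>

text \<open>With \<open>p c a = c + g (a - c)\<close> modulo \<open>n\<close>, everything depends on
  \<open>d = a - c\<close>. Exchanging \<open>c\<close> and \<open>a\<close> turns \<open>d\<close>
  into \<open>n - d\<close>, so \<open>p c a = p a c\<close> means that
  \<open>g d - g (n - d)\<close> is congruent to \<open>d\<close>. By the range of \<open>g\<close>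
  only the values \<open>d\<close> and \<open>d - n\<close> can occur.\<close>

lemma oriented_extremal_cyclic:
  fixes g :: "int \<Rightarrow> int"
  assumes "odd n"
    and g0: "g 0 = 0"
    and range: "\<And>d. 0 < d \<Longrightarrow> d < int n \<Longrightarrow> 0 < g d \<and> g d < int n"
    and invol: "\<And>d. 0 < d \<Longrightarrow> d < int n \<Longrightarrow> g (g d) = d"
    and moved: "\<And>d. 0 < d \<Longrightarrow> d < int n \<Longrightarrow> g d \<noteq> d"
    and anticomm: "\<And>d. 0 < d \<Longrightarrow> d < int n \<Longrightarrow>
      g d - g (int n - d) \<noteq> d \<and> g d - g (int n - d) \<noteq> d - int n"
  shows "\<exists>H. verts H = {..<n} \<and> is_two_one_graph H \<and> oriented H \<and> is_free I1 H \<and>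
    card (edges H) = n * ((n - 1) div 2)"
proof -
  have n: "0 < int n" using assms(1) by (auto elim: oddE)
  define diff where "diff c a = (int a - int c) mod int n" for c a
  define p where "p c a = nat ((int c + g (diff c a)) mod int n)" for c a
  have int_p: "int (p c a) = (int c + g (diff c a)) mod int n" for c a
    using n by (simp add: p_def)
  have range': "0 \<le> g d \<and> g d < int n" if "0 \<le> d" "d < int n" for d
    using range[of d] g0 that n by (cases "d = 0") auto
  have invol': "g (g d) = d" if "0 \<le> d" "d < int n" for d
    using invol[of d] g0 that by (cases "d = 0") auto
  have diff: "0 \<le> diff c a" "diff c a < int n" for c a
    using n by (auto simp: diff_def)
  \<comment> \<open>In the coordinate \<open>diff c\<close> the map \<open>p c\<close> becomes
    \<open>g\<close>. As this coordinate is injective on \<open>{..<n}\<close>, properties of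
    \<open>g\<close> carry over to \<open>p c\<close>.\<close>
  have diff_p: "diff c (p c a) = g (diff c a)" for c a
  proof -
    have "diff c (p c a) = g (diff c a) mod int n"
      unfolding diff_def[of c "p c a"] int_p by (simp add: mod_diff_left_eq)
    then show ?thesis using range' diff by simp
  qed
  have diff_eq: "a = b" if "diff c a = diff c b" "a < n" "b < n" for a b c
  proof -
    have "(int a - int c + int c) mod int n = (int b - int c + int c) mod int n"
      using that(1) unfolding diff_def by (rule mod_add_cong) simp
    then show ?thesis using that by simp
  qed
  have p_lt: "p c a < n" for c a
    using n by (simp add: p_def nat_less_iff)
  have diff_pos: "0 < diff c a" if "c < n" "a < n" "c \<noteq> a" for c a
  proof -
    have "diff c a \<noteq> diff c c" using diff_eq that by metis
    then show ?thesis using diff(1)[of c a] by (simp add: diff_def)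
  qed
  have diff_swap: "diff a c = int n - diff c a" if "c < n" "a < n" "c \<noteq> a" for a c
    using diff_pos[OF that] zmod_zminus1_eq_if[of "int a - int c" "int n"]
    by (auto simp: diff_def)
  have fixed: "p c a = a \<longleftrightarrow> a = c" if "c < n" "a < n" for c a
  proof
    assume "p c a = a"
    then have "g (diff c a) = diff c a" using diff_p[of c a] by simp
    then show "a = c" using moved diff_pos[OF that] diff by metis
  next
    assume "a = c"
    then have "diff c (p c a) = diff c a" using diff_p[of c a] g0 by (simp add: diff_def)
    then show "p c a = a" using diff_eq p_lt that by metis
  qed
  have "\<exists>H. verts H = {..<n} \<and> is_two_one_graph H \<and> oriented H \<and> is_free I1 H \<and>
    card (edges H) = card {..<n} * ((n - 1) div 2)"
  proof (rule oriented_graph_of_operation[of _ p])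
    fix c a assume ca: "c \<in> {..<n}" "a \<in> {..<n}"
    show "p c a \<in> {..<n}" using p_lt by simp
    have "diff c (p c (p c a)) = diff c a"
      unfolding diff_p using invol' diff by simp
    then show "p c (p c a) = a" using diff_eq p_lt ca by simp
    assume "c \<noteq> a"
    show "p c a \<noteq> p a c"
    proof
      assume "p c a = p a c"
      let ?d = "diff c a"
      have d: "0 < ?d" "?d < int n" using diff_pos diff ca \<open>c \<noteq> a\<close> by auto
      have "(int c + g ?d) mod int n = (int a + g (int n - ?d)) mod int n"
        using \<open>p c a = p a c\<close> \<open>c \<noteq> a\<close> ca diff_swap[of c a]
        by (metis int_p lessThan_iff)
      then have "int n dvd (int c + g ?d) - (int a + g (int n - ?d))"
        by (simp add: mod_eq_dvd_iff)
      moreover have "int n dvd (int a - int c) - ?d"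
        unfolding diff_def by (rule dvd_minus_mod)
      ultimately have "int n dvd ((int c + g ?d) - (int a + g (int n - ?d))) + ((int a - int c) - ?d)"
        by (rule dvd_add)
      then have "int n dvd g ?d - g (int n - ?d) - ?d" by (simp add: algebra_simps)
      then obtain j where j: "g ?d - g (int n - ?d) - ?d = int n * j" by (auto simp: dvd_def)
      have bounds: "0 < g ?d" "g ?d < int n" "0 < g (int n - ?d)" "g (int n - ?d) < int n"
        using range[of ?d] range[of "int n - ?d"] d by auto
      \<comment> \<open>The multiple of \<open>n\<close> lies strictly between \<open>-2n\<close>
        and \<open>n\<close>; the remaining values 0 and \<open>-n\<close> are the two cases of
        \<open>anticomm\<close>.\<close>
      have "int n * j < int n * 1" "int n * (-2) < int n * j"
        using j bounds d by linarith+
      then have "j = 0 \<or> j = -1" using n by (simp only: mult_less_cancel_left_pos) linarith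
      then show False using anticomm[OF d] j by auto
    qed
  next
    fix c assume c: "c \<in> {..<n}"
    then have "{a \<in> {..<n}. p c a \<noteq> a} = {..<n} - {c}" using fixed by auto
    then show "card {a \<in> {..<n}. p c a \<noteq> a} = 2 * ((n - 1) div 2)"
      using c assms(1) by (auto elim!: oddE)
  qed (use fixed in auto)
  then show ?thesis by simp
qed

lemma oriented_extremal_odd:
  assumes "odd n" "n > 3"
  shows "\<exists>H. verts H = {..<n} \<and> is_two_one_graph H \<and> oriented H \<and> is_free I1 H \<and>
    card (edges H) = n * ((n - 1) div 2)"
proof (cases "3 dvd n")
  case False
  then have "\<not> 3 dvd int n" by presburger
  \<comment> \<open>For the reflection \<open>g d = n - d\<close> the difference
    \<open>g d - g (n - d)\<close> is \<open>n - 2d\<close>; it equals \<open>d\<close> or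
    \<open>d - n\<close> only if \<open>n = 3d\<close> or \<open>2n = 3d\<close>. A moved point
    failing to move would need \<open>n = 2d\<close>.\<close>
  then have n3: "int n \<noteq> 3 * d" "2 * int n \<noteq> 3 * d" for d :: int
    by presburger+
  have odd2: "int n \<noteq> 2 * d" for d using assms(1) by presburger
  show ?thesis
    by (rule oriented_extremal_cyclic[where g = "\<lambda>d. if d = 0 then 0 else int n - d"])
      (use assms n3 odd2 in \<open>force+\<close>)
next
  case True
  then obtain k where k: "int n = 3 * k" by (metis dvdE of_nat_mult of_nat_numeral)
  \<comment> \<open>For \<open>k = 1\<close> the swaps below would collapse to fixed points. For
    \<open>k = 2\<close> the coincidence at \<open>d = k\<close> would persist, since there
    \<open>g k - g (2 * k) = 2 - 3 * k\<close> equals \<open>d - n = -2 * k\<close>.\<close>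
  then have k3: "k \<ge> 3" and odd2: "3 * k \<noteq> 2 * d" for d using assms by presburger+
  \<comment> \<open>Modulo \<open>3 * k\<close> this exchanges 1 with \<open>k\<close> and -1 with
    \<open>-k\<close>, and reflects all other residues. Both residues \<open>k\<close> and
    \<open>2 * k\<close> where the reflection fails are thus rerouted.\<close>
  define g where "g d = (if d = 0 then 0 else if d = 1 then k else if d = k then 1
    else if d = 3 * k - 1 then 2 * k else if d = 2 * k then 3 * k - 1 else 3 * k - d)" for d
  show ?thesis
  proof (rule oriented_extremal_cyclic[where g = g])
    fix d assume d: "0 < d" "d < int n"
    show "0 < g d \<and> g d < int n" "g (g d) = d" "g d \<noteq> d"
      using d k3 odd2[of d] unfolding k g_def by (auto split: if_splits)
    show "g d - g (int n - d) \<noteq> d \<and> g d - g (int n - d) \<noteq> d - int n"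
      using d k3 unfolding k g_def by (auto split: if_splits)
  qed (use assms in \<open>auto simp: g_def\<close>)
qed

section \<open>Both extremal numbers and the number of extremal graphs\<close>

theorem theorem3p1:
  fixes n :: nat
  assumes "n \<ge> 4"
  shows "ex_number n I1 = n * ((n - 1) div 2) \<and>
    ex_oriented_number n I1 = n * ((n - 1) div 2) \<and>
    real (card {H :: nat two_one_graph. is_two_one_graph H \<and> verts H = {1..n} \<and>
        is_free I1 H \<and> card (edges H) = ex_number n I1})
      = (fact (n - 1) / (2 ^ ((n - 1) div 2) * fact ((n - 1) div 2))) ^ n"
proof -
  \<comment> \<open>One oriented graph attains both maxima, and the bound for all
    \<open>I1\<close>-free graphs covers the oriented ones.\<close>
  obtain H :: "nat two_one_graph" where H: "verts H = {..<n}" "is_two_one_graph H" "oriented H"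
    "is_free I1 H" "card (edges H) = n * ((n - 1) div 2)"
    using oriented_extremal_even[of n] oriented_extremal_odd[of n] assms
    by (cases "even n") auto
  then have cardH: "card (verts H) = n" by simp
  have ex: "ex_number n I1 = n * ((n - 1) div 2)"
    unfolding ex_number_def
  proof (rule Max_eqI[OF finite_free_edge_counts(1)])
    show "n * ((n - 1) div 2) \<in> {card (edges H) | H :: nat two_one_graph.
        is_two_one_graph H \<and> card (verts H) = n \<and> is_free I1 H}"
      using H cardH by (intro CollectI exI[of _ H]) simp
  qed (use card_edges_free_le in blast)
  moreover have "ex_oriented_number n I1 = n * ((n - 1) div 2)"
    unfolding ex_oriented_number_def
  proof (rule Max_eqI[OF finite_free_edge_counts(2)])
    show "n * ((n - 1) div 2) \<in> {card (edges H) | H :: nat two_one_graph.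
        is_two_one_graph H \<and> card (verts H) = n \<and> oriented H \<and> is_free I1 H}"
      using H cardH by (intro CollectI exI[of _ H]) simp
  qed (use card_edges_free_le in blast)
  ultimately show ?thesis
    using card_extremal_graphs[of "{1..n}"] by simp
qed

end
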